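(* Let $P_{X,Y}$ be a joint probability distribution on $\{-1,1\}^2$ and let $\mathcal{U}=\mathcal{V}=\{-1,1\}$. Then $\mathcal{P}_{EA}(P_{X,Y},\mathcal{U},\mathcal{V})=\mathcal{P}_{CR}(P_{X,Y},\mathcal{U},\mathcal{V})$.
   Context: Let $P_{X,Y}$ be a distribution on $\{-1,1\}^2$, and let $\mathcal{U},\mathcal{V}$ be finite sets. For $d\in\mathbb{N}$, $(X^d,Y^d)=((X_1,Y_1),\dots,(X_d,Y_d))$ is i.i.d. with law $P_{X,Y}$. A stochastic function is a function whose output may also depend on private randomness, independent of everything else (in particular, the private randomness of Alice and that of Bob are independent); equivalently, a Markov kernel from inputs to outputs. $d_{TV}$ is total variation distance. Entanglement-assisted simulation (EA-NISS). The Bell state is $|\Phi^+\rangle=\frac{1}{\sqrt2}(|00\rangle+|11\rangle)\in\mathbb{C}^2\otimes\mathbb{C}^2$. A measurement with finite outcome set $\mathcal{Z}$ is a family $(\Lambda_z)_{z\in\mathcal{Z}}$ of positive semidefinite Hermitian $2\times2$ matrices with $\sum_z\Lambda_z=\mathbb{I}$. If Alice and Bob apply measurements $(\Lambda_{1,z})_z$ and $(\Lambda_{2,z})_z$ to their halves of $|\Phi^+\rangle$, their outcomes $(Z_1,Z_2)$ have law $P(Z_1=z_1,Z_2=z_2)=\langle\Phi^+|\Lambda_{1,z_1}\otimes\Lambda_{2,z_2}|\Phi^+\rangle$, and $(Z_1,Z_2)$ is independent of $(X^d,Y^d)$. For a finite set $\mathcal{Z}$, $\mathcal{P}_{EA}(P_{X,Y},\mathcal{U},\mathcal{V},\mathcal{Z})$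 is the set of distributions $Q_{U,V}$ on $\mathcal{U}\times\mathcal{V}$ for which there exist, for each $d\in\mathbb{N}$, measurements $(\Lambda_{d,1,z})_{z\in\mathcal{Z}}$, $(\Lambda_{d,2,z})_{z\in\mathcal{Z}}$ with outcomes $Z_{1,d},Z_{2,d}$, and (possibly stochastic) functions $f_d:\mathcal{Z}\times\{-1,1\}^d\to\mathcal{U}$, $g_d:\mathcal{Z}\times\{-1,1\}^d\to\mathcal{V}$, such that the law $P^{(d)}$ of $(f_d(Z_{1,d},X^d),g_d(Z_{2,d},Y^d))$ satisfies $\lim_{d\to\infty}d_{TV}(P^{(d)},Q_{U,V})=0$. Define $\mathcal{P}_{EA}(P_{X,Y},\mathcal{U},\mathcal{V})=\bigcup_{n\in\mathbb{N}}\mathcal{P}_{EA}(P_{X,Y},\mathcal{U},\mathcal{V},\{1,2,\dots,n\})$. Common-randomness simulation (CR-NISS). $\mathcal{P}_{CR}(P_{X,Y},\mathcal{U},\mathcal{V})$ is the set of distributions $Q_{U,V}$ on $\mathcal{U}\times\mathcal{V}$ for which there exist, for each $d\in\mathbb{N}$, (possibly stochastic) functions $f_d:\{-1,1\}^{d+1}\to\mathcal{U}$ and $g_d:\{-1,1\}^{d+1}\to\mathcal{V}$ such that the law $P^{(d)}$ of $(f_d(Z,X^d),g_d(Z,Y^d))$ satisfies $\lim_{d\to\infty}d_{TV}(P^{(d)},Q_{U,V})=0$, where $Z$ is uniform on $\{-1,1\}$ and independent of $(X^d,Y^d)$. *)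

theory Defs
  imports "HOL-Probability.Probability"
begin

section \<open>Measuring a shared Bell state\<close>

definition hermitian :: "complex ^ 'n ^ 'n \<Rightarrow> bool" where
  "hermitian A \<longleftrightarrow> (\<forall>i j. A $ j $ i = cnj (A $ i $ j))"

text \<open>The scalar \<open>\<langle>x|A|x\<rangle>\<close>, conjugate-linear in the left argument.\<close>

definition sandwich :: "complex ^ 'n \<Rightarrow> complex ^ 'n ^ 'n \<Rightarrow> complex" where
  "sandwich x A = (\<Sum>i\<in>UNIV. cnj (x $ i) * (A *v x) $ i)"

definition pos_semidef :: "complex ^ 'n ^ 'n \<Rightarrow> bool" where
  "pos_semidef A \<longleftrightarrow> hermitian A \<and> (\<forall>x. 0 \<le> Re (sandwich x A))"

definition measurement :: "'z set \<Rightarrow> ('z \<Rightarrow> complex ^ 2 ^ 2) \<Rightarrow> bool" where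
  "measurement Z L \<longleftrightarrow> (\<forall>z\<in>Z. pos_semidef (L z)) \<and> (\<Sum>z\<in>Z. L z) = mat 1"

text \<open>
  The tensor product of two coordinate spaces is the coordinate space indexed by pairs.
\<close>

definition tensor_mat ::
  "complex ^ 'n ^ 'n \<Rightarrow> complex ^ 'm ^ 'm \<Rightarrow> complex ^ ('n \<times> 'm) ^ ('n \<times> 'm)" where
  "tensor_mat A B = (\<chi> i j. A $ fst i $ fst j * B $ snd i $ snd j)"

text \<open>The index type \<^typ>\<open>2\<close> has exactly the two elements \<open>0\<close> and \<open>1\<close>.\<close>

definition bell_state :: "complex ^ (2 \<times> 2)" where
  "bell_state = (1 / sqrt 2) *\<^sub>R (axis (0, 0) 1 + axis (1, 1) 1)"

text \<open>
  \<open>R\<close> is the joint law of the two outcomes. The equation is between complex numbers, so it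
  also says that the right-hand side is real.
\<close>

definition bell_outcome_law ::
  "'z set \<Rightarrow> ('z \<Rightarrow> complex ^ 2 ^ 2) \<Rightarrow> ('z \<Rightarrow> complex ^ 2 ^ 2) \<Rightarrow> ('z \<times> 'z) pmf \<Rightarrow> bool" where
  "bell_outcome_law Z L1 L2 R \<longleftrightarrow>
     set_pmf R \<subseteq> Z \<times> Z \<and>
     (\<forall>z1\<in>Z. \<forall>z2\<in>Z.
        complex_of_real (pmf R (z1, z2)) = sandwich bell_state (tensor_mat (L1 z1) (L2 z2)))"

section \<open>Simulation of joint distributions\<close>

definition tv_dist :: "'a pmf \<Rightarrow> 'a pmf \<Rightarrow> real" where
  "tv_dist p q = (SUP A. \<bar>measure_pmf.prob p A - measure_pmf.prob q A\<bar>)"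

definition sign_words :: "nat \<Rightarrow> int list set" where
  "sign_words d = {xs. set xs \<subseteq> {-1, 1} \<and> length xs = d}"

text \<open>
  A stochastic function is a Markov kernel, i.e. a \<^const>\<open>pmf\<close>-valued function. In both laws
  below the two kernels are sampled independently given their inputs (\<^const>\<open>pair_pmf\<close>): the
  private randomness of the two parties is independent. A sample of
  \<^term>\<open>replicate_pmf d P\<close> is the i.i.d. sequence of pairs.
\<close>

definition ea_law ::
  "(int \<times> int) pmf \<Rightarrow> nat \<Rightarrow> ('z \<times> 'z) pmf \<Rightarrow>
   ('z \<Rightarrow> int list \<Rightarrow> 'u pmf) \<Rightarrow> ('z \<Rightarrow> int list \<Rightarrow> 'v pmf) \<Rightarrow> ('u \<times> 'v) pmf" where
  "ea_law P d R f g =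
     do {
       (z1, z2) \<leftarrow> R;
       xy \<leftarrow> replicate_pmf d P;
       pair_pmf (f z1 (map fst xy)) (g z2 (map snd xy))
     }"

definition P_EA_outcomes ::
  "(int \<times> int) pmf \<Rightarrow> 'u set \<Rightarrow> 'v set \<Rightarrow> 'z set \<Rightarrow> ('u \<times> 'v) pmf set" where
  "P_EA_outcomes P U V Z =
     {Q. set_pmf Q \<subseteq> U \<times> V \<and>
         (\<exists>L1 L2 R f g.
            (\<forall>d. measurement Z (L1 d) \<and> measurement Z (L2 d) \<and>
                 bell_outcome_law Z (L1 d) (L2 d) (R d) \<and>
                 (\<forall>z\<in>Z. \<forall>xs\<in>sign_words d.
                    set_pmf (f d z xs) \<subseteq> U \<and> set_pmf (g d z xs) \<subseteq> V)) \<and>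
            (\<lambda>d. tv_dist (ea_law P d (R d) (f d) (g d)) Q) \<longlonglongrightarrow> 0)}"

definition P_EA ::
  "(int \<times> int) pmf \<Rightarrow> 'u set \<Rightarrow> 'v set \<Rightarrow> ('u \<times> 'v) pmf set" where
  "P_EA P U V = (\<Union>n. P_EA_outcomes P U V {1..n :: nat})"

definition cr_law ::
  "(int \<times> int) pmf \<Rightarrow> nat \<Rightarrow> (int list \<Rightarrow> 'u pmf) \<Rightarrow> (int list \<Rightarrow> 'v pmf) \<Rightarrow>
   ('u \<times> 'v) pmf" where
  "cr_law P d f g =
     do {
       z \<leftarrow> pmf_of_set {-1, 1};
       xy \<leftarrow> replicate_pmf d P;
       pair_pmf (f (z # map fst xy)) (g (z # map snd xy))
     }"

definition P_CR ::
  "(int \<times> int) pmf \<Rightarrow> 'u set \<Rightarrow> 'v set \<Rightarrow> ('u \<times> 'v) pmf set" where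
  "P_CR P U V =
     {Q. set_pmf Q \<subseteq> U \<times> V \<and>
         (\<exists>f g.
            (\<forall>d. \<forall>xs\<in>sign_words (Suc d).
               set_pmf (f d xs) \<subseteq> U \<and> set_pmf (g d xs) \<subseteq> V) \<and>
            (\<lambda>d. tv_dist (cr_law P d (f d) (g d)) Q) \<longlonglongrightarrow> 0)}"

end

theory Submission
  imports Defs
begin

text \<open>
  Both models agree already for each fixed \<open>d\<close>. A \<open>\<plusminus>1\<close>-valued strategy turns the effects of a
  party into a trace part, which acts as a local response probability, and a Bloch vector bounded
  by the slack of that probability. The output law depends on
  the vectors only through the number \<open>E (a(X) \<bullet> b(Y))\<close>, which by Cauchy--Schwarz equals
  \<open>\<tau> E (\<parallel>a(X)\<parallel> \<parallel>b(Y)\<parallel>)\<close> for some \<open>\<tau> \<in> [-1, 1]\<close>. Hence a common bit that shifts the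
  responses by \<open>\<plusminus>\<tau> \<parallel>a\<parallel>\<close> and \<open>\<plusminus>\<parallel>b\<parallel>\<close> produces the same law. Conversely, measuring the Bell
  state in the computational basis yields a common bit.
\<close>

section \<open>Bloch coordinates\<close>

lemma UNIV_2_zero_one: "(UNIV :: 2 set) = {0, 1}"
proof -
  have "(0::2) = 2" by simp
  then show ?thesis using UNIV_2 by auto
qed

lemma sum_UNIV_2: "(\<Sum>i\<in>(UNIV :: 2 set). h i) = h 0 + h 1"
  by (simp add: UNIV_2_zero_one)

lemma forall_2_zero_one: "(\<forall>i::2. Q i) \<longleftrightarrow> Q 0 \<and> Q 1"
  using UNIV_2_zero_one by (metis UNIV_I empty_iff insert_iff)

text \<open>The Bell vector is nonzero only at \<open>(0, 0)\<close> and \<open>(1, 1)\<close>, so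
  only the products of equally placed entries survive. The value is half the trace of
  \<open>A\<close> times the transpose of \<open>B\<close>.\<close>

lemma sandwich_bell_tensor:
  "sandwich bell_state (tensor_mat A B) =
     (A $ 0 $ 0 * B $ 0 $ 0 + A $ 0 $ 1 * B $ 0 $ 1 + A $ 1 $ 0 * B $ 1 $ 0 + A $ 1 $ 1 * B $ 1 $ 1) / 2"
proof -
  have sum_pairs: "(\<Sum>i\<in>(UNIV :: (2 \<times> 2) set). h i) = h (0, 0) + h (0, 1) + h (1, 0) + h (1, 1)"
    for h :: "2 \<times> 2 \<Rightarrow> complex"
    unfolding UNIV_Times_UNIV[symmetric] sum.Sigma[symmetric] UNIV_2_zero_one
    by (simp add: sum.cartesian_product' add.assoc)
  define r where "r = complex_of_real (1 / sqrt 2)"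
  have bell: "bell_state $ p = (if p = (0, 0) \<or> p = (1, 1) then r else 0)" for p
    by (auto simp: bell_state_def axis_def r_def of_real_def)
  have "r * r = complex_of_real (1 / sqrt 2 * (1 / sqrt 2))"
    unfolding r_def by (rule of_real_mult[symmetric])
  then have "r * r = 1 / 2"
    by simp
  then have r: "r * (x * r) = x / 2" for x
    by (metis mult.assoc mult.commute mult.right_neutral times_divide_eq_right)
  have "cnj r = r"
    by (simp add: r_def)
  show ?thesis
    by (simp add: sandwich_def matrix_vector_mult_def tensor_mat_def sum_pairs bell
        \<open>cnj r = r\<close> r distrib_left add_divide_distrib)
qed

definition bloch_trace :: "complex ^ 2 ^ 2 \<Rightarrow> real" where
  "bloch_trace A = (Re (A $ 0 $ 0) + Re (A $ 1 $ 1)) / 2"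

text \<open>For Hermitian \<open>A\<close> these are the Pauli coordinates
  \<open>(z, x - i y)\<close> of \<open>A\<close>, with \<open>bloch_trace A\<close> as the
  coefficient of the identity. The product of \<open>real\<close> and \<open>complex\<close> serves
  as Euclidean 3-space, so its norm and inner product are the ones wanted.\<close>

definition bloch_vector :: "complex ^ 2 ^ 2 \<Rightarrow> real \<times> complex" where
  "bloch_vector A = ((Re (A $ 0 $ 0) - Re (A $ 1 $ 1)) / 2, A $ 0 $ 1)"

lemma hermitian_2:
  fixes A :: "complex ^ 2 ^ 2"
  assumes "hermitian A"
  shows "Im (A $ 0 $ 0) = 0" "Im (A $ 1 $ 1) = 0" "A $ 1 $ 0 = cnj (A $ 0 $ 1)"
proof -
  have "A $ 0 $ 0 = cnj (A $ 0 $ 0)" "A $ 1 $ 1 = cnj (A $ 1 $ 1)"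
    using assms unfolding hermitian_def by blast+
  then show "Im (A $ 0 $ 0) = 0" "Im (A $ 1 $ 1) = 0"
    by (simp_all add: complex_eq_iff)
  show "A $ 1 $ 0 = cnj (A $ 0 $ 1)"
    using assms unfolding hermitian_def by blast
qed

text \<open>The last bound is nonnegativity of the determinant, obtained by testing the quadratic
  form on well-chosen vectors.\<close>

lemma pos_semidef_2:
  fixes A :: "complex ^ 2 ^ 2"
  assumes "pos_semidef A"
  defines "p \<equiv> Re (A $ 0 $ 0)" and "q \<equiv> Re (A $ 1 $ 1)" and "c \<equiv> A $ 0 $ 1"
  shows "0 \<le> p" "0 \<le> q" "(cmod c)\<^sup>2 \<le> p * q"
proof -
  have herm: "hermitian A"
    using assms by (simp add: pos_semidef_def)
  have diag: "A $ 0 $ 0 = of_real p" "A $ 1 $ 1 = of_real q"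
    using hermitian_2[OF herm] by (auto simp: complex_eq_iff p_def q_def)
  have quad: "0 \<le> Re (cnj x * (p * x + c * y) + cnj y * (cnj c * x + q * y))" for x y :: complex
  proof -
    define e :: "complex ^ 2" where "e = (\<chi> i. if i = 0 then x else y)"
    have "0 \<le> Re (sandwich e A)"
      using assms by (simp add: pos_semidef_def)
    then show ?thesis
      by (simp add: sandwich_def matrix_vector_mult_def sum_UNIV_2 e_def diag hermitian_2[OF herm]
          flip: c_def)
  qed
  show p: "0 \<le> p" using quad[of 1 0] by simp
  show q: "0 \<le> q" using quad[of 0 1] by simp
  have norm_c: "(cmod c)\<^sup>2 = (Re c)\<^sup>2 + (Im c)\<^sup>2"
    by (simp add: cmod_power2)
  \<comment> \<open>The vectors \<open>(-c, p)\<close> and \<open>(q, - cnj c)\<close> are the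
    columns of the adjugate. Each annihilates one row, which leaves the determinant times
    \<open>p\<close> or \<open>q\<close>. Both facts are vacuous if \<open>p = q = 0\<close>; the
    vector \<open>(-c, 1)\<close> then forces \<open>c = 0\<close>.\<close>
  have 1: "0 \<le> p * (p * q - (cmod c)\<^sup>2)"
    using quad[of "- c" "of_real p"] unfolding norm_c
    by (simp add: power2_eq_square algebra_simps)
  have 2: "0 \<le> q * (p * q - (cmod c)\<^sup>2)"
    using quad[of "of_real q" "- cnj c"] unfolding norm_c
    by (simp add: power2_eq_square algebra_simps)
  have 3: "2 * (cmod c)\<^sup>2 \<le> p * (cmod c)\<^sup>2 + q"
    using quad[of "- c" 1] unfolding norm_c
    by (simp add: power2_eq_square algebra_simps)
  show "(cmod c)\<^sup>2 \<le> p * q"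
  proof (cases "p = 0 \<and> q = 0")
    case True
    then show ?thesis using 3 by simp
  next
    case False
    then show ?thesis using 1 2 p q by (auto simp: zero_le_mult_iff)
  qed
qed

text \<open>The smaller eigenvalue is \<open>bloch_trace A - norm (bloch_vector A)\<close>.
  Concretely, \<open>((p + q) / 2)\<^sup>2 - ((p - q) / 2)\<^sup>2 = p * q\<close>, which dominates
  \<open>(cmod c)\<^sup>2\<close>.\<close>

lemma norm_bloch_vector_le:
  assumes "pos_semidef A"
  shows "norm (bloch_vector A) \<le> bloch_trace A"
proof -
  define p q c where "p = Re (A $ 0 $ 0)" and "q = Re (A $ 1 $ 1)" and "c = A $ 0 $ 1"
  have pq: "0 \<le> p" "0 \<le> q" "(cmod c)\<^sup>2 \<le> p * q"
    using pos_semidef_2[OF assms] by (simp_all add: p_def q_def c_def)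
  have "norm (bloch_vector A) = sqrt (((p - q) / 2)\<^sup>2 + (cmod c)\<^sup>2)"
    by (simp add: bloch_vector_def norm_prod_def power_divide p_def q_def c_def)
  also have "\<dots> \<le> (p + q) / 2"
    using pq by (intro real_le_lsqrt) (auto simp: power2_eq_square field_simps)
  finally show ?thesis
    by (simp add: bloch_trace_def p_def q_def)
qed

text \<open>Both coordinates are additive, and the identity matrix has trace part 1 and Bloch vector
  0.\<close>

lemma measurement_bloch_sums:
  assumes "measurement Z L"
  shows "(\<Sum>z\<in>Z. bloch_trace (L z)) = 1" "(\<Sum>z\<in>Z. bloch_vector (L z)) = 0"
proof -
  have entry: "(\<Sum>z\<in>Z. L z $ i $ j) = (if i = j then 1 else 0)" for i j
  proof -
    have "(\<Sum>z\<in>Z. L z) $ i $ j = mat 1 $ i $ j"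
      using assms by (simp add: measurement_def)
    then show ?thesis by (simp add: mat_def)
  qed
  have re: "(\<Sum>z\<in>Z. Re (L z $ i $ i)) = 1" for i
    using arg_cong[OF entry[of i i], of Re] by simp
  show "(\<Sum>z\<in>Z. bloch_trace (L z)) = 1"
    by (simp add: bloch_trace_def re sum.distrib flip: sum_divide_distrib)
  have "fst (\<Sum>z\<in>Z. bloch_vector (L z)) = 0" "snd (\<Sum>z\<in>Z. bloch_vector (L z)) = 0"
    by (simp_all add: fst_sum snd_sum bloch_vector_def re entry sum_subtractf
        flip: sum_divide_distrib)
  then show "(\<Sum>z\<in>Z. bloch_vector (L z)) = 0"
    by (simp add: prod_eq_iff)
qed

text \<open>
  Against the Bell state, Bob's effect acts through its transpose, whose Bloch vector has the
  conjugate off-diagonal entry.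
\<close>

lemma bell_outcome_law_bloch:
  assumes "bell_outcome_law Z L1 L2 R" "measurement Z L1" "measurement Z L2" "z1 \<in> Z" "z2 \<in> Z"
  shows "pmf R (z1, z2) = bloch_trace (L1 z1) * bloch_trace (L2 z2) +
           bloch_vector (L1 z1) \<bullet> map_prod id cnj (bloch_vector (L2 z2))"
proof -
  have "hermitian (L1 z1)" "hermitian (L2 z2)"
    using assms by (auto simp: measurement_def pos_semidef_def)
  note herm = hermitian_2[OF this(1)] hermitian_2[OF this(2)]
  have "complex_of_real (pmf R (z1, z2)) = sandwich bell_state (tensor_mat (L1 z1) (L2 z2))"
    using assms by (simp add: bell_outcome_law_def)
  then have "pmf R (z1, z2) = Re (sandwich bell_state (tensor_mat (L1 z1) (L2 z2)))"
    by (metis Re_complex_of_real)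
  then show ?thesis
    by (simp add: sandwich_bell_tensor herm bloch_trace_def bloch_vector_def inner_complex_def)
      (simp add: field_simps)
qed

section \<open>Reducing an effect to one common bit\<close>

text \<open>The weights \<open>w\<close> merge the outcomes into one effect. As the vectors sum to
  0, the complementary weights \<open>1 - w\<close> give the opposite vector, so the second bound is
  the first one applied to them. Together they provide the room for shifting a probability both up
  and down.\<close>

lemma norm_weighted_sum_le:
  fixes a :: "'z \<Rightarrow> 'a::real_normed_vector"
  assumes "(\<Sum>z\<in>Z. t z) = 1" "(\<Sum>z\<in>Z. a z) = 0"
    and "\<And>z. z \<in> Z \<Longrightarrow> norm (a z) \<le> t z" "\<And>z. z \<in> Z \<Longrightarrow> 0 \<le> w z \<and> w z \<le> 1"
  shows "norm (\<Sum>z\<in>Z. w z *\<^sub>R a z) \<le> (\<Sum>z\<in>Z. w z * t z)"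
    and "norm (\<Sum>z\<in>Z. w z *\<^sub>R a z) \<le> 1 - (\<Sum>z\<in>Z. w z * t z)"
proof -
  have le: "norm (\<Sum>z\<in>Z. w' z *\<^sub>R a z) \<le> (\<Sum>z\<in>Z. w' z * t z)"
    if "\<And>z. z \<in> Z \<Longrightarrow> 0 \<le> w' z" for w'
    using that assms(3) by (intro sum_norm_le) (auto intro!: mult_left_mono)
  show "norm (\<Sum>z\<in>Z. w z *\<^sub>R a z) \<le> (\<Sum>z\<in>Z. w z * t z)"
    using assms(4) by (intro le) auto
  have "norm (\<Sum>z\<in>Z. (1 - w z) *\<^sub>R a z) \<le> (\<Sum>z\<in>Z. (1 - w z) * t z)"
    using assms(4) by (intro le) auto
  then show "norm (\<Sum>z\<in>Z. w z *\<^sub>R a z) \<le> 1 - (\<Sum>z\<in>Z. w z * t z)"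
    using assms(1,2) by (simp add: algebra_simps sum_subtractf)
qed

section \<open>Distributions on two signs\<close>

definition sign_pmf :: "real \<Rightarrow> int pmf" where
  "sign_pmf p = map_pmf (\<lambda>b. if b then 1 else -1) (bernoulli_pmf p)"

lemma set_sign_pmf: "set_pmf (sign_pmf p) \<subseteq> {-1, 1}"
  by (auto simp: sign_pmf_def)

lemma pmf_sign_pmf:
  assumes "0 \<le> p" "p \<le> 1"
  shows "pmf (sign_pmf p) 1 = p" "pmf (sign_pmf p) (-1) = 1 - p"
proof -
  let ?h = "\<lambda>b. if b then 1 else -1 :: int"
  have inj: "inj ?h" by (auto simp: inj_def)
  show "pmf (sign_pmf p) 1 = p" "pmf (sign_pmf p) (-1) = 1 - p"
    using pmf_map_inj'[OF inj, of "bernoulli_pmf p" True]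
      pmf_map_inj'[OF inj, of "bernoulli_pmf p" False] assms
    by (simp_all add: sign_pmf_def)
qed

lemma pmf_minus_one:
  assumes "set_pmf p \<subseteq> {-1, 1 :: int}"
  shows "pmf p (-1) = 1 - pmf p 1"
proof -
  have "sum (pmf p) {-1, 1} = 1"
    using assms by (intro sum_pmf_eq_1) auto
  then show ?thesis by simp
qed

section \<open>The two laws\<close>

lemma finite_set_replicate_pmf:
  assumes "finite (set_pmf P)"
  shows "finite (set_pmf (replicate_pmf d P))"
  using finite_lists_length_eq[OF assms, of d]
  by (simp add: set_replicate_pmf lists_eq_set)

lemma replicate_pmf_sign_words:
  assumes "set_pmf P \<subseteq> {-1, 1} \<times> {-1, 1}" "xy \<in> set_pmf (replicate_pmf d P)"
  shows "map fst xy \<in> sign_words d" "map snd xy \<in> sign_words d"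
  using assms by (fastforce simp: set_replicate_pmf sign_words_def)+

text \<open>Drawing the source before the measurement outcomes leaves one expectation over
  \<open>xy\<close>, the same outer form as for \<open>cr_law\<close>, so the integrands can be
  compared.\<close>

lemma pmf_ea_law:
  assumes "finite Z" "set_pmf R \<subseteq> Z \<times> Z"
  shows "pmf (ea_law P d R f g) (u, v) =
    measure_pmf.expectation (replicate_pmf d P) (\<lambda>xy. \<Sum>z1\<in>Z. \<Sum>z2\<in>Z.
      pmf (f z1 (map fst xy)) u * pmf (g z2 (map snd xy)) v * pmf R (z1, z2))"
proof -
  have "ea_law P d R f g = do {
       xy \<leftarrow> replicate_pmf d P;
       z \<leftarrow> R;
       pair_pmf (f (fst z) (map fst xy)) (g (snd z) (map snd xy))}"
    unfolding ea_law_def case_prod_unfold by (rule bind_commute_pmf)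
  moreover have "measure_pmf.expectation R (\<lambda>z. pmf (f (fst z) xs) u * pmf (g (snd z) ys) v) =
      (\<Sum>z1\<in>Z. \<Sum>z2\<in>Z. pmf (f z1 xs) u * pmf (g z2 ys) v * pmf R (z1, z2))" for xs ys
    using assms
    by (subst integral_measure_pmf_real[of "Z \<times> Z"])
      (auto simp: sum.cartesian_product case_prod_unfold)
  ultimately show ?thesis
    by (simp add: pmf_bind pmf_pair)
qed

lemma pmf_cr_law:
  "pmf (cr_law P d f g) (u, v) =
    measure_pmf.expectation (replicate_pmf d P) (\<lambda>xy.
      (pmf (f (1 # map fst xy)) u * pmf (g (1 # map snd xy)) v +
       pmf (f (-1 # map fst xy)) u * pmf (g (-1 # map snd xy)) v) / 2)"
proof -
  have "cr_law P d f g = do {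
       xy \<leftarrow> replicate_pmf d P;
       z \<leftarrow> pmf_of_set {-1, 1};
       pair_pmf (f (z # map fst xy)) (g (z # map snd xy))}"
    unfolding cr_law_def by (rule bind_commute_pmf)
  then show ?thesis
    by (simp add: pmf_bind pmf_pair integral_pmf_of_set add.commute)
qed

lemma set_ea_law:
  assumes "set_pmf P \<subseteq> {-1, 1} \<times> {-1, 1}" "set_pmf R \<subseteq> Z \<times> Z"
    and "\<And>z xs. z \<in> Z \<Longrightarrow> xs \<in> sign_words d \<Longrightarrow> set_pmf (f z xs) \<subseteq> U \<and> set_pmf (g z xs) \<subseteq> V"
  shows "set_pmf (ea_law P d R f g) \<subseteq> U \<times> V"
proof
  fix w assume "w \<in> set_pmf (ea_law P d R f g)"
  then obtain z1 z2 xy where "(z1, z2) \<in> set_pmf R" and xy: "xy \<in> set_pmf (replicate_pmf d P)"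
    and w: "w \<in> set_pmf (f z1 (map fst xy)) \<times> set_pmf (g z2 (map snd xy))"
    by (auto simp: ea_law_def)
  then have "z1 \<in> Z" "z2 \<in> Z"
    using assms(2) by auto
  then have "set_pmf (f z1 (map fst xy)) \<subseteq> U" "set_pmf (g z2 (map snd xy)) \<subseteq> V"
    using assms(3) replicate_pmf_sign_words[OF assms(1) xy] by blast+
  with w show "w \<in> U \<times> V" by blast
qed

lemma set_cr_law:
  assumes "\<And>xs. set_pmf (f xs) \<subseteq> U" "\<And>xs. set_pmf (g xs) \<subseteq> V"
  shows "set_pmf (cr_law P d f g) \<subseteq> U \<times> V"
  using assms by (fastforce simp: cr_law_def)

text \<open>The two models are matched on average, not for each \<open>xy\<close>: the integrands
  differ in \<open>a \<bullet> b\<close> against \<open>\<tau> * (norm a * norm b)\<close>, and only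
  the expectations of these agree. The kernels found thus depend on \<open>P\<close> and
  \<open>d\<close> through \<open>\<tau>\<close>.\<close>

lemma ea_law_is_cr_law:
  fixes P :: "(int \<times> int) pmf" and f g :: "'z \<Rightarrow> int list \<Rightarrow> int pmf"
  assumes P: "set_pmf P \<subseteq> {-1, 1} \<times> {-1, 1}" and Z: "finite Z"
    and L: "measurement Z L1" "measurement Z L2" and R: "bell_outcome_law Z L1 L2 R"
    and fg: "\<And>z xs. z \<in> Z \<Longrightarrow> xs \<in> sign_words d \<Longrightarrow>
      set_pmf (f z xs) \<subseteq> {-1, 1} \<and> set_pmf (g z xs) \<subseteq> {-1, 1}"
  obtains f' g' where "\<And>xs. set_pmf (f' xs) \<subseteq> {-1, 1}" "\<And>xs. set_pmf (g' xs) \<subseteq> {-1, 1}"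
    "cr_law P d f' g' = ea_law P d R f g"
proof -
  define W where "W = replicate_pmf d P"
  define s t where "s z = bloch_trace (L1 z)" and "t z = bloch_trace (L2 z)" for z
  \<comment> \<open>The conjugation is absorbed into \<open>\<beta>\<close>, so that the correlation
    becomes a plain inner product.\<close>
  define \<alpha> \<beta> where "\<alpha> z = bloch_vector (L1 z)"
    and "\<beta> z = map_prod id cnj (bloch_vector (L2 z))" for z
  have R_supp: "set_pmf R \<subseteq> Z \<times> Z"
    using R by (simp add: bell_outcome_law_def)
  have pmf_R: "pmf R (z1, z2) = s z1 * t z2 + \<alpha> z1 \<bullet> \<beta> z2" if "z1 \<in> Z" "z2 \<in> Z" for z1 z2
    using bell_outcome_law_bloch[OF R L that] by (simp add: s_def t_def \<alpha>_def \<beta>_def)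
  have sums: "sum s Z = 1" "sum \<alpha> Z = 0" "sum t Z = 1"
    using measurement_bloch_sums[OF L(1)] measurement_bloch_sums[OF L(2)]
    by (simp_all add: s_def t_def \<alpha>_def)
  have "sum \<beta> Z = map_prod id cnj (\<Sum>z\<in>Z. bloch_vector (L2 z))"
    by (simp add: \<beta>_def prod_eq_iff fst_sum snd_sum)
  then have sum_\<beta>: "sum \<beta> Z = 0"
    using measurement_bloch_sums[OF L(2)] by (simp add: prod_eq_iff)
  have le_s: "norm (\<alpha> z) \<le> s z" if "z \<in> Z" for z
    using norm_bloch_vector_le L that by (auto simp: measurement_def \<alpha>_def s_def)
  have "norm (\<beta> z) = norm (bloch_vector (L2 z))" for z
    by (simp add: \<beta>_def norm_prod_def)
  then have le_t: "norm (\<beta> z) \<le> t z" if "z \<in> Z" for z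
    using norm_bloch_vector_le L that by (auto simp: measurement_def t_def)

  \<comment> \<open>Since the vectors sum to 0, \<open>s\<close> and \<open>t\<close> are the
    marginal outcome laws. Hence \<open>A u xs\<close> and \<open>B u xs\<close> are the local
    probabilities of answering \<open>u\<close>, while \<open>a\<close> and \<open>b\<close> below
    are the Bloch parts of the merged effects for the answer 1.\<close>
  define A B where "A u xs = (\<Sum>z\<in>Z. pmf (f z xs) u * s z)"
    and "B u xs = (\<Sum>z\<in>Z. pmf (g z xs) u * t z)" for u xs
  define a b where "a xs = (\<Sum>z\<in>Z. pmf (f z xs) 1 *\<^sub>R \<alpha> z)"
    and "b xs = (\<Sum>z\<in>Z. pmf (g z xs) 1 *\<^sub>R \<beta> z)" for xs
  have a_le: "norm (a xs) \<le> A 1 xs" "norm (a xs) \<le> 1 - A 1 xs" for xs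
    unfolding a_def A_def using sums le_s
    by (auto intro!: norm_weighted_sum_le simp: pmf_le_1)
  have b_le: "norm (b xs) \<le> B 1 xs" "norm (b xs) \<le> 1 - B 1 xs" for xs
    unfolding b_def B_def using sums sum_\<beta> le_t
    by (auto intro!: norm_weighted_sum_le simp: pmf_le_1)
  have f_flip: "pmf (f z xs) (-1) = 1 - pmf (f z xs) 1" and
    g_flip: "pmf (g z xs) (-1) = 1 - pmf (g z xs) 1" if "z \<in> Z" "xs \<in> sign_words d" for z xs
    using fg[OF that] by (auto intro: pmf_minus_one)
  have A_flip: "A (-1) xs = 1 - A 1 xs" and B_flip: "B (-1) xs = 1 - B 1 xs"
    if "xs \<in> sign_words d" for xs
    using that sums by (simp_all add: A_def B_def f_flip g_flip algebra_simps sum_subtractf)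
  \<comment> \<open>Here the binary alphabet enters: the effects for the two answers have opposite
    vectors, and the answer itself is the sign.\<close>
  have a_sign: "(\<Sum>z\<in>Z. pmf (f z xs) u *\<^sub>R \<alpha> z) = real_of_int u *\<^sub>R a xs" and
    b_sign: "(\<Sum>z\<in>Z. pmf (g z xs) u *\<^sub>R \<beta> z) = real_of_int u *\<^sub>R b xs"
    if "xs \<in> sign_words d" "u \<in> {-1, 1}" for xs u
    using that sums sum_\<beta>
    by (auto simp: a_def b_def f_flip g_flip algebra_simps sum_subtractf)

  have ea_kernel: "(\<Sum>z1\<in>Z. \<Sum>z2\<in>Z. pmf (f z1 xs) u * pmf (g z2 ys) v * pmf R (z1, z2)) =
      A u xs * B v ys + real_of_int u * real_of_int v * (a xs \<bullet> b ys)"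
    if "xs \<in> sign_words d" "ys \<in> sign_words d" "u \<in> {-1, 1}" "v \<in> {-1, 1}" for xs ys u v
  proof -
    have "(\<Sum>z1\<in>Z. \<Sum>z2\<in>Z. pmf (f z1 xs) u * pmf (g z2 ys) v * pmf R (z1, z2)) =
        (\<Sum>z1\<in>Z. \<Sum>z2\<in>Z. (pmf (f z1 xs) u * s z1) * (pmf (g z2 ys) v * t z2) +
          (pmf (f z1 xs) u *\<^sub>R \<alpha> z1) \<bullet> (pmf (g z2 ys) v *\<^sub>R \<beta> z2))"
      by (intro sum.cong refl) (simp add: pmf_R algebra_simps)
    also have "\<dots> = A u xs * B v ys +
        (\<Sum>z\<in>Z. pmf (f z xs) u *\<^sub>R \<alpha> z) \<bullet> (\<Sum>z\<in>Z. pmf (g z ys) v *\<^sub>R \<beta> z)"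
      unfolding A_def B_def sum.distrib sum_product inner_sum_left inner_sum_right
      by (subst (4) sum.swap) simp
    finally show ?thesis
      using a_sign[OF that(1,3)] b_sign[OF that(2,4)] by simp
  qed

  define I J where "I = measure_pmf.expectation W (\<lambda>xy. a (map fst xy) \<bullet> b (map snd xy))"
    and "J = measure_pmf.expectation W (\<lambda>xy. norm (a (map fst xy)) * norm (b (map snd xy)))"
  have "finite (set_pmf P)"
    using P by (rule finite_subset) simp
  then have integrable: "integrable W h" for h :: "_ \<Rightarrow> real"
    unfolding W_def by (intro integrable_measure_pmf_finite finite_set_replicate_pmf)
  have "\<bar>I\<bar> \<le> measure_pmf.expectation W (\<lambda>xy. \<bar>a (map fst xy) \<bullet> b (map snd xy)\<bar>)"
    unfolding I_def by (rule integral_abs_bound)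
  also have "\<dots> \<le> J"
    unfolding J_def by (intro integral_mono integrable Cauchy_Schwarz_ineq2)
  finally have I_le_J: "\<bar>I\<bar> \<le> J" .
  \<comment> \<open>If \<open>J = 0\<close>, then \<open>I = 0\<close> too, and division by zero
    yields \<open>\<tau> = 0\<close>, so \<open>I = \<tau> * J\<close> still holds.\<close>
  define \<tau> where "\<tau> = I / J"
  have I_eq: "I = \<tau> * J" and \<tau>_le: "\<bar>\<tau>\<bar> \<le> 1"
    using I_le_J by (auto simp: \<tau>_def divide_le_eq)

  \<comment> \<open>The head of the word is the common bit, the tail the party's own source symbols.
    The whole factor \<open>\<tau>\<close> is placed on Alice's side.\<close>
  define f' where "f' = (\<lambda>zs. sign_pmf (A 1 (tl zs) + of_int (hd zs) * \<tau> * norm (a (tl zs))))"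
  define g' where "g' = (\<lambda>zs. sign_pmf (B 1 (tl zs) + of_int (hd zs) * norm (b (tl zs))))"
  have pmf_f': "pmf (f' (z # xs)) u = A u xs + of_int u * of_int z * \<tau> * norm (a xs)"
    if "xs \<in> sign_words d" "z \<in> {-1, 1}" "u \<in> {-1, 1}" for xs z u
  proof -
    have "\<bar>of_int z * \<tau> * norm (a xs)\<bar> \<le> norm (a xs)"
      using \<tau>_le that(2) by (auto simp: abs_mult intro!: mult_left_le_one_le)
    then have "0 \<le> A 1 xs + of_int z * \<tau> * norm (a xs)" "A 1 xs + of_int z * \<tau> * norm (a xs) \<le> 1"
      using a_le[of xs] by linarith+
    from pmf_sign_pmf[OF this] that(3) show ?thesis
      by (auto simp: f'_def A_flip[OF that(1)])
  qed
  have pmf_g': "pmf (g' (z # xs)) u = B u xs + of_int u * of_int z * norm (b xs)"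
    if "xs \<in> sign_words d" "z \<in> {-1, 1}" "u \<in> {-1, 1}" for xs z u
  proof -
    have "\<bar>of_int z * norm (b xs)\<bar> \<le> norm (b xs)"
      using that(2) by (auto simp: abs_mult)
    then have "0 \<le> B 1 xs + of_int z * norm (b xs)" "B 1 xs + of_int z * norm (b xs) \<le> 1"
      using b_le[of xs] by linarith+
    from pmf_sign_pmf[OF this] that(3) show ?thesis
      by (auto simp: g'_def B_flip[OF that(1)])
  qed
  \<comment> \<open>Averaging over the bit cancels the terms linear in it, and the product of the
    two shifts remains because the bit squares to 1.\<close>
  have cr_kernel: "(pmf (f' (1 # xs)) u * pmf (g' (1 # ys)) v +
        pmf (f' (-1 # xs)) u * pmf (g' (-1 # ys)) v) / 2 =
      A u xs * B v ys + real_of_int u * real_of_int v * (\<tau> * (norm (a xs) * norm (b ys)))"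
    if "xs \<in> sign_words d" "ys \<in> sign_words d" "u \<in> {-1, 1}" "v \<in> {-1, 1}" for xs ys u v
    using that by (simp add: pmf_f' pmf_g') (simp add: algebra_simps)

  have words: "map fst xy \<in> sign_words d" "map snd xy \<in> sign_words d" if "xy \<in> set_pmf W" for xy
    using replicate_pmf_sign_words[OF P] that unfolding W_def by blast+
  have pmf_eq: "pmf (cr_law P d f' g') (u, v) = pmf (ea_law P d R f g) (u, v)"
    if uv: "u \<in> {-1, 1}" "v \<in> {-1, 1}" for u v
  proof -
    let ?M = "measure_pmf.expectation W (\<lambda>xy. A u (map fst xy) * B v (map snd xy))"
    have "pmf (ea_law P d R f g) (u, v) = measure_pmf.expectation W (\<lambda>xy.
        A u (map fst xy) * B v (map snd xy) +
        real_of_int u * real_of_int v * (a (map fst xy) \<bullet> b (map snd xy)))"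
      unfolding pmf_ea_law[OF Z R_supp] W_def[symmetric]
      by (intro integral_cong_AE AE_pmfI ea_kernel words uv) auto
    also have "\<dots> = ?M + real_of_int u * real_of_int v * I"
      by (simp add: integrable I_def)
    also have "\<dots> = measure_pmf.expectation W (\<lambda>xy.
        A u (map fst xy) * B v (map snd xy) +
        real_of_int u * real_of_int v * (\<tau> * (norm (a (map fst xy)) * norm (b (map snd xy)))))"
      by (simp add: integrable I_eq J_def)
    also have "\<dots> = pmf (cr_law P d f' g') (u, v)"
      unfolding pmf_cr_law W_def[symmetric]
      by (intro integral_cong_AE AE_pmfI cr_kernel[symmetric] words uv) auto
    finally show ?thesis by simp
  qed
  have f'_supp: "set_pmf (f' xs) \<subseteq> {-1, 1}" and g'_supp: "set_pmf (g' xs) \<subseteq> {-1, 1}" for xs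
    unfolding f'_def g'_def by (rule set_sign_pmf)+
  have "cr_law P d f' g' = ea_law P d R f g"
  proof (rule pmf_eqI)
    fix w :: "int \<times> int"
    obtain u v where w: "w = (u, v)" by fastforce
    show "pmf (cr_law P d f' g') w = pmf (ea_law P d R f g) w"
    proof (cases "u \<in> {-1, 1} \<and> v \<in> {-1, 1}")
      case True
      then show ?thesis using pmf_eq w by blast
    next
      case False
      then have "w \<notin> set_pmf (cr_law P d f' g')" "w \<notin> set_pmf (ea_law P d R f g)"
        using set_cr_law[of f' _ g', OF f'_supp g'_supp] set_ea_law[of P R Z d f _ g, OF P R_supp fg] w by blast+
      then show ?thesis by (simp add: set_pmf_iff)
    qed
  qed
  with f'_supp g'_supp that show ?thesis by blast
qed

section \<open>The two inclusions\<close>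

lemma P_EA_subset_P_CR:
  assumes P: "set_pmf P \<subseteq> {-1, 1} \<times> {-1, 1}"
  shows "P_EA P {-1, 1 :: int} {-1, 1 :: int} \<subseteq> P_CR P {-1, 1} {-1, 1}"
proof
  fix Q :: "(int \<times> int) pmf" assume "Q \<in> P_EA P {-1, 1} {-1, 1}"
  then obtain n :: nat where "Q \<in> P_EA_outcomes P {-1, 1} {-1, 1} {1..n}"
    unfolding P_EA_def by blast
  then obtain L1 L2 R f g where Q: "set_pmf Q \<subseteq> {-1, 1} \<times> {-1, 1}"
    and sim: "\<forall>d. measurement {1..n} (L1 d) \<and> measurement {1..n} (L2 d) \<and>
      bell_outcome_law {1..n} (L1 d) (L2 d) (R d) \<and>
      (\<forall>z\<in>{1..n}. \<forall>xs\<in>sign_words d.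
         set_pmf (f d z xs) \<subseteq> {-1, 1} \<and> set_pmf (g d z xs) \<subseteq> {-1, 1})"
    and lim: "(\<lambda>d. tv_dist (ea_law P d (R d) (f d) (g d)) Q) \<longlonglongrightarrow> 0"
    unfolding P_EA_outcomes_def mem_Collect_eq
    by (elim conjE exE) (rule that)
  \<comment> \<open>Both kernels are packed into one pair, so that a single use of choice selects
    them for all \<open>d\<close>.\<close>
  have "\<exists>h. (\<forall>xs. set_pmf (fst h xs) \<subseteq> {-1, 1} \<and> set_pmf (snd h xs) \<subseteq> {-1, 1}) \<and>
      cr_law P d (fst h) (snd h) = ea_law P d (R d) (f d) (g d)" for d
  proof (rule ea_law_is_cr_law)
    show "set_pmf P \<subseteq> {-1, 1} \<times> {-1, 1}" "finite {1..n}"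
      by (fact P, simp)
    show "measurement {1..n} (L1 d)" "measurement {1..n} (L2 d)"
      "bell_outcome_law {1..n} (L1 d) (L2 d) (R d)"
      using sim by blast+
    show "set_pmf (f d z xs) \<subseteq> {-1, 1} \<and> set_pmf (g d z xs) \<subseteq> {-1, 1}"
      if "z \<in> {1..n}" "xs \<in> sign_words d" for z xs
      using sim that by blast
  next
    fix f' g' :: "int list \<Rightarrow> int pmf"
    assume "\<And>xs. set_pmf (f' xs) \<subseteq> {-1, 1}" "\<And>xs. set_pmf (g' xs) \<subseteq> {-1, 1}"
      "cr_law P d f' g' = ea_law P d (R d) (f d) (g d)"
    then show ?thesis by (intro exI[of _ "(f', g')"]) simp
  qed
  then obtain h where h: "\<forall>d. (\<forall>xs. set_pmf (fst (h d) xs) \<subseteq> {-1, 1} \<and> set_pmf (snd (h d) xs) \<subseteq> {-1, 1}) \<and>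
      cr_law P d (fst (h d)) (snd (h d)) = ea_law P d (R d) (f d) (g d)"
    using choice[of "\<lambda>d h. (\<forall>xs. set_pmf (fst h xs) \<subseteq> {-1, 1} \<and> set_pmf (snd h xs) \<subseteq> {-1, 1}) \<and>
      cr_law P d (fst h) (snd h) = ea_law P d (R d) (f d) (g d)"] by blast
  have "(\<lambda>d. tv_dist (cr_law P d (fst (h d)) (snd (h d))) Q) \<longlonglongrightarrow> 0"
    using lim h by simp
  with Q h show "Q \<in> P_CR P {-1, 1} {-1, 1}"
    unfolding P_CR_def mem_Collect_eq
    by (intro conjI exI[of _ "\<lambda>d. fst (h d)"] exI[of _ "\<lambda>d. snd (h d)"]) blast+
qed

text \<open>The given kernels are kept, with the common bit read off from the measurement outcome.
  The laws are then equal for every \<open>d\<close>, and the limit carries over.\<close>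

lemma P_CR_subset_P_EA: "P_CR P U V \<subseteq> P_EA P U V"
proof
  fix Q assume "Q \<in> P_CR P U V"
  then obtain f g where Q: "set_pmf Q \<subseteq> U \<times> V"
    and supp: "\<forall>d. \<forall>xs\<in>sign_words (Suc d). set_pmf (f d xs) \<subseteq> U \<and> set_pmf (g d xs) \<subseteq> V"
    and lim: "(\<lambda>d. tv_dist (cr_law P d (f d) (g d)) Q) \<longlonglongrightarrow> 0"
    unfolding P_CR_def mem_Collect_eq
    by (elim conjE exE) (rule that)
  \<comment> \<open>Outcomes are labelled 1 and 2, as \<open>P_EA\<close> requires;
    \<open>bit\<close> translates them into signs.\<close>
  define bit :: "nat \<Rightarrow> int" where "bit z = (if z = 1 then -1 else 1)" for z
  \<comment> \<open>\<open>L 1\<close> and \<open>L 2\<close> are the projections onto the basis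
    vectors 0 and 1. When both parties use them, the outcomes coincide and are uniform, which is the
    law \<open>R\<close>.\<close>
  define L :: "nat \<Rightarrow> complex ^ 2 ^ 2" where
    "L z = (\<chi> i j. if i = j \<and> (i = 0 \<longleftrightarrow> z = 1) then 1 else 0)" for z
  define R :: "(nat \<times> nat) pmf" where "R = map_pmf (\<lambda>z. (z, z)) (pmf_of_set {1, 2})"
  have outcomes: "{1..2} = {1, 2 :: nat}" by auto
  have "pos_semidef (L z)" for z
    by (auto simp: pos_semidef_def hermitian_def L_def sandwich_def matrix_vector_mult_def
        sum_UNIV_2)
  moreover have "L 1 + L 2 = mat 1"
    by (simp add: vec_eq_iff L_def mat_def forall_2_zero_one)
  ultimately have meas: "measurement {1..2} L"
    unfolding measurement_def outcomes by simp
  have "pmf R (z1, z2) = (if z1 = z2 then 1 / 2 else 0)" if "z1 \<in> {1, 2}" "z2 \<in> {1, 2}" for z1 z2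
  proof (cases "z1 = z2")
    case True
    have "inj (\<lambda>z :: nat. (z, z))" by (simp add: inj_def)
    from pmf_map_inj'[OF this, of "pmf_of_set {1, 2}" z1] show ?thesis
      using True that by (auto simp: R_def)
  next
    case False
    then show ?thesis by (auto simp: R_def set_pmf_iff[symmetric] pmf_eq_0_set_pmf)
  qed
  moreover have "set_pmf R \<subseteq> {1, 2} \<times> {1, 2}"
    by (auto simp: R_def)
  ultimately have law: "bell_outcome_law {1..2} L L R"
    by (auto simp: bell_outcome_law_def outcomes sandwich_bell_tensor L_def)
  have "pmf_of_set {-1, 1} = map_pmf bit (pmf_of_set {1, 2})"
    by (subst map_pmf_of_set_inj) (auto simp: bit_def inj_on_def insert_commute)
  then have eq: "cr_law P d (f d) (g d) =
      ea_law P d R (\<lambda>z xs. f d (bit z # xs)) (\<lambda>z xs. g d (bit z # xs))" for d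
    by (simp add: cr_law_def ea_law_def R_def map_pmf_def bind_assoc_pmf bind_return_pmf)
  have word: "bit z # xs \<in> sign_words (Suc d)" if "xs \<in> sign_words d" for z xs d
    using that by (auto simp: sign_words_def bit_def)
  have "Q \<in> P_EA_outcomes P U V {1..2 :: nat}"
    unfolding P_EA_outcomes_def mem_Collect_eq
    using Q supp word meas law lim unfolding eq
    by (intro conjI exI[of _ "\<lambda>_. L"] exI[of _ "\<lambda>_. R"]
        exI[of _ "\<lambda>d z xs. f d (bit z # xs)"] exI[of _ "\<lambda>d z xs. g d (bit z # xs)"]) blast+
  then show "Q \<in> P_EA P U V"
    unfolding P_EA_def by blast
qed

theorem theorem1:
  fixes P :: "(int \<times> int) pmf" and U V :: "int set"
  assumes "set_pmf P \<subseteq> {-1, 1} \<times> {-1, 1}"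
    and "U = {-1, 1}" and "V = {-1, 1}"
  shows "P_EA P U V = P_CR P U V"
  using P_EA_subset_P_CR[OF assms(1)] P_CR_subset_P_EA[of P U V] assms(2,3) by blast

end
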